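(* Let $\Omega$ be an r.e. infinite set, and let $P\in\mathbb{P}(\Omega)$ be a discrete probability space on $\Omega$. Let $B\subset\Omega$ be a recursive event with $P(B)>0$. For every ensemble $\alpha$ for $P$, the sequence $\mathrm{Filtered}_B(\alpha)$ is an ensemble for $P_B$.
   Context: Alphabets and sequences. $\mathbb{N}^+=\{1,2,3,\dots\}$. For a nonempty set $\Omega$ (alphabet), $\Omega^*$ is the set of finite strings over $\Omega$ (including the empty string $\lambda$), and $\Omega^\infty$ is the set of infinite sequences $\alpha=\alpha(1)\alpha(2)\alpha(3)\cdots$ over $\Omega$; $\alpha\upharpoonright_n$ is the string of the first $n$ elements of $\alpha$. A set $S\subset\Omega^*$ is prefix-free if no string in $S$ is a prefix of another string in $S$. For $S\subset\Omega^*$, $[S]^{\prec}=\{\alpha\in\Omega^\infty\mid \exists n\ge 0,\ \alpha\upharpoonright_n\in S\}$. An r.e. infinite set is an infinite recursively enumerable set (of finite objects usable as Turing machine inputs). A recursive event is a subset of $\Omega$ that is a recursive set. Probability spaces. For a countably infinite set $\Omega$, a discrete probability space on $\Omega$ is a function $P\colon\Omega\to\mathbb{R}$ with $P(a)\ge 0$ for all $a$ and $\sum_{a\in\Omega}P(a)=1$ (no computability is assumed); a finite probability space is defined in the same way for a nonempty finite $\Omega$. In both cases $\mathbb{P}(\Omega)$ is the set of all such functions. An event is a subset $A\subset\Omega$, and $P(A)=\sum_{a\in A}P(a)$. For $\sigma=\sigma_1\cdots\sigma_n\in\Omega^*$, $P(\sigma)=P(\sigma_1)\cdots P(\sigma_n)$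 and $P(\lambda)=1$. The (generalized) Bernoulli measure $\lambda_P$ is the probability measure on the Borel $\sigma$-field of $\Omega^\infty$ (generated by the open sets $[S]^{\prec}$, $S\subset\Omega^*$) determined by $\lambda_P([\{\sigma\}]^{\prec})=P(\sigma)$ for all $\sigma\in\Omega^*$. Ensembles. Let $\Omega$ be an r.e. infinite set or a nonempty finite set, and $P\in\mathbb{P}(\Omega)$. A Martin-Löf $P$-test is an r.e. set $\mathcal{C}\subset\mathbb{N}^+\times\Omega^*$ such that for every $n\in\mathbb{N}^+$ the set $\mathcal{C}_n=\{\sigma\mid(n,\sigma)\in\mathcal{C}\}$ is prefix-free and $\lambda_P([\mathcal{C}_n]^{\prec})<2^{-n}$. A sequence $\alpha\in\Omega^\infty$ is Martin-Löf $P$-random if for every Martin-Löf $P$-test $\mathcal{C}$ there is $n\in\mathbb{N}^+$ with $\alpha\notin[\mathcal{C}_n]^{\prec}$. An ensemble for $P$ is a Martin-Löf $P$-random sequence in $\Omega^\infty$. Conditioning. For an event $B$ with $P(B)>0$, $P_B\in\mathbb{P}(B)$ is the (finite or discrete) probability space on $B$ given by $P_B(a)=P(\{a\}\cap B)/P(B)$, $a\in B$. If $\alpha\in\Omega^\infty$ contains infinitely many elements of $B$, $\mathrm{Filtered}_B(\alpha)\in B^\infty$ is the infinite sequence obtained from $\alpha$ by deleting all occurrences of elements of $\Omega\setminus B$. (If $\alpha$ is an ensemble for $P$ and $P(B)>0$, then $\alpha$ contains infinitely many elements of $B$, so $\mathrm{Filtered}_B(\alpha)$ is well defined.) *)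

theory Defs
  imports "HOL-Probability.Probability" "HOL-Library.Nat_Bijection" "HOL-Library.Sublist"
begin

section \<open>Recursive functions and sets\<close>

text \<open>
  \<open>recursive_fun n f\<close>: the \<open>n\<close>-ary function \<open>f\<close> is (total) recursive.  Only the values of
  \<open>f\<close> on argument lists of length \<open>n\<close> are meaningful.  Minimization is only applied to regular
  functions, i.e. where a zero always exists; by Kleene's normal form theorem the functions
  obtained in this way are exactly the total computable ones.
\<close>

inductive recursive_fun :: "nat \<Rightarrow> (nat list \<Rightarrow> nat) \<Rightarrow> bool" where
  zero: "recursive_fun n (\<lambda>xs. 0)"
| succ: "recursive_fun 1 (\<lambda>xs. Suc (xs ! 0))"
| proj: "i < n \<Longrightarrow> recursive_fun n (\<lambda>xs. xs ! i)"
| comp: "recursive_fun (length gs) f \<Longrightarrow> \<forall>g\<in>set gs. recursive_fun n g \<Longrightarrow>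
    recursive_fun n (\<lambda>xs. f (map (\<lambda>g. g xs) gs))"
| prim_rec: "recursive_fun n f \<Longrightarrow> recursive_fun (Suc (Suc n)) g \<Longrightarrow>
    recursive_fun (Suc n) (\<lambda>xs. rec_nat (f (tl xs)) (\<lambda>y r. g (y # r # tl xs)) (hd xs))"
| minimize: "recursive_fun (Suc n) f \<Longrightarrow> \<forall>xs. length xs = n \<longrightarrow> (\<exists>y. f (y # xs) = 0) \<Longrightarrow>
    recursive_fun n (\<lambda>xs. LEAST y. f (y # xs) = 0)"

definition recursive_set :: "nat set \<Rightarrow> bool" where
  "recursive_set A \<longleftrightarrow>
    (\<exists>f. recursive_fun 1 f \<and> (\<forall>x. f [x] = (if x \<in> A then 1 else 0)))"

definition re_set :: "nat set \<Rightarrow> bool" where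
  "re_set A \<longleftrightarrow> A = {} \<or> (\<exists>f. recursive_fun 1 f \<and> A = range (\<lambda>x. f [x]))"

text \<open>
  The finite objects serving as alphabet symbols are identified with natural numbers.  Pairs of a
  number and a string over such an alphabet are coded by the standard computable bijections.
\<close>

definition re_pairs :: "(nat \<times> nat list) set \<Rightarrow> bool" where
  "re_pairs C \<longleftrightarrow> re_set ((\<lambda>(n, \<sigma>). prod_encode (n, list_encode \<sigma>)) ` C)"


section \<open>Probability spaces and Bernoulli measures\<close>

text \<open>
  A function on \<open>\<Omega>\<close> is represented by a total function whose values outside \<open>\<Omega>\<close> are ignored.
\<close>

definition prob_on :: "'a set \<Rightarrow> ('a \<Rightarrow> real) \<Rightarrow> bool" where
  "prob_on \<Omega> P \<longleftrightarrow> (\<forall>a\<in>\<Omega>. 0 \<le> P a) \<and> (P has_sum 1) \<Omega>"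

definition event_prob :: "('a \<Rightarrow> real) \<Rightarrow> 'a set \<Rightarrow> real" where
  "event_prob P A = (\<Sum>\<^sub>\<infinity>a\<in>A. P a)"

definition string_prob :: "('a \<Rightarrow> real) \<Rightarrow> 'a list \<Rightarrow> real" where
  "string_prob P \<sigma> = prod_list (map P \<sigma>)"

definition conditioned :: "('a \<Rightarrow> real) \<Rightarrow> 'a set \<Rightarrow> 'a \<Rightarrow> real" where
  "conditioned P B a = event_prob P ({a} \<inter> B) / event_prob P B"

definition generated_open :: "'a set \<Rightarrow> 'a list set \<Rightarrow> 'a stream set" where
  "generated_open \<Omega> S = {\<alpha> \<in> streams \<Omega>. \<exists>n. stake n \<alpha> \<in> S}"

definition bernoulli_measure :: "'a set \<Rightarrow> ('a \<Rightarrow> real) \<Rightarrow> 'a stream measure" where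
  "bernoulli_measure \<Omega> P = stream_space (point_measure \<Omega> (\<lambda>a. ennreal (P a)))"


section \<open>Martin-Loef randomness\<close>

definition prefix_free :: "'a list set \<Rightarrow> bool" where
  "prefix_free S \<longleftrightarrow> (\<forall>\<sigma>\<in>S. \<forall>\<tau>\<in>S. prefix \<sigma> \<tau> \<longrightarrow> \<sigma> = \<tau>)"

definition martin_loef_test :: "nat set \<Rightarrow> (nat \<Rightarrow> real) \<Rightarrow> (nat \<times> nat list) set \<Rightarrow> bool" where
  "martin_loef_test \<Omega> P C \<longleftrightarrow>
    C \<subseteq> {1..} \<times> lists \<Omega> \<and> re_pairs C \<and>
    (\<forall>n\<ge>1. prefix_free {\<sigma>. (n, \<sigma>) \<in> C} \<and>
      measure (bernoulli_measure \<Omega> P) (generated_open \<Omega> {\<sigma>. (n, \<sigma>) \<in> C}) < 1 / 2 ^ n)"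

definition martin_loef_random :: "nat set \<Rightarrow> (nat \<Rightarrow> real) \<Rightarrow> nat stream \<Rightarrow> bool" where
  "martin_loef_random \<Omega> P \<alpha> \<longleftrightarrow>
    \<alpha> \<in> streams \<Omega> \<and>
    (\<forall>C. martin_loef_test \<Omega> P C \<longrightarrow> (\<exists>n\<ge>1. \<alpha> \<notin> generated_open \<Omega> {\<sigma>. (n, \<sigma>) \<in> C}))"

definition ensemble :: "nat set \<Rightarrow> (nat \<Rightarrow> real) \<Rightarrow> nat stream \<Rightarrow> bool" where
  "ensemble \<Omega> P \<alpha> \<longleftrightarrow> martin_loef_random \<Omega> P \<alpha>"

text \<open>Unspecified unless \<open>\<alpha>\<close> contains infinitely many elements of \<open>B\<close>.\<close>

definition filtered :: "'a set \<Rightarrow> 'a stream \<Rightarrow> 'a stream" where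
  "filtered B \<alpha> = sfilter (\<lambda>a. a \<in> B) \<alpha>"


section \<open>The Bernoulli measure is the one determined by its values on cylinders\<close>

lemma prob_space_point_measure:
  assumes "prob_on \<Omega> P"
  shows "prob_space (point_measure \<Omega> (\<lambda>a. ennreal (P a)))"
proof
  have nn: "\<And>a. a \<in> \<Omega> \<Longrightarrow> 0 \<le> P a" and hs: "(P has_sum 1) \<Omega>"
    using assms by (auto simp: prob_on_def)
  have "P summable_on \<Omega>" using hs by (auto simp: summable_on_def)
  then have abs: "(\<lambda>a. norm (P a)) summable_on \<Omega>"
    using nn by (simp cong: summable_on_cong)
  then have "(\<integral>\<^sup>+a. ennreal (P a) \<partial>count_space \<Omega>) = ennreal (infsum P \<Omega>)"
    using nn by (subst nn_integral_conv_infsetsum)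
      (auto simp: infsetsum_infsum abs_summable_equivalent[symmetric])
  also have "\<dots> = 1" using hs by (simp add: infsumI)
  also have "(\<integral>\<^sup>+a. ennreal (P a) \<partial>count_space \<Omega>) =
      (\<integral>\<^sup>+a. ennreal (P a) * indicator \<Omega> a \<partial>count_space \<Omega>)"
    by (rule nn_integral_cong) simp
  finally show "emeasure (point_measure \<Omega> (\<lambda>a. ennreal (P a)))
      (space (point_measure \<Omega> (\<lambda>a. ennreal (P a)))) = 1"
    by (simp add: point_measure_def emeasure_density space_point_measure)
qed

lemma generated_open_singleton:
  assumes "\<sigma> \<in> lists \<Omega>"
  shows "generated_open \<Omega> {\<sigma>} = sstart \<Omega> \<sigma>"
proof -
  have "(\<exists>n. stake n \<alpha> = \<sigma>) \<longleftrightarrow> (\<forall>i<length \<sigma>. \<alpha> !! i = \<sigma> ! i)" for \<alpha> :: "'a stream"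
    by (auto simp: list_eq_iff_nth_eq intro!: exI[of _ "length \<sigma>"])
  then show ?thesis
    using sstart_in_streams[OF assms] by (auto simp: generated_open_def sstart_eq)
qed

lemma sets_bernoulli_measure:
  assumes "countable \<Omega>"
  shows "sets (bernoulli_measure \<Omega> P) =
    sigma_sets (streams \<Omega>) ((\<lambda>\<sigma>. generated_open \<Omega> {\<sigma>}) ` lists \<Omega> \<union> {{}})"
proof -
  have "sets (bernoulli_measure \<Omega> P) = sets (stream_space (count_space \<Omega>))"
    unfolding bernoulli_measure_def
    by (rule sets_stream_space_cong) (simp add: sets_point_measure)
  also have "\<dots> = sigma_sets (streams \<Omega>) (sstart \<Omega> ` lists \<Omega> \<union> {{}})"
    unfolding sets_stream_space_sstart[OF assms]
    using sstart_in_streams[of _ \<Omega>] by (intro sets_measure_of) (auto simp del: in_lists_conv_set)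
  also have "sstart \<Omega> ` lists \<Omega> = (\<lambda>\<sigma>. generated_open \<Omega> {\<sigma>}) ` lists \<Omega>"
    by (rule image_cong) (simp_all add: generated_open_singleton del: in_lists_conv_set)
  finally show ?thesis .
qed

lemma emeasure_bernoulli_measure_cylinder:
  assumes "countable \<Omega>" "prob_on \<Omega> P" "\<sigma> \<in> lists \<Omega>"
  shows "emeasure (bernoulli_measure \<Omega> P) (generated_open \<Omega> {\<sigma>}) = ennreal (string_prob P \<sigma>)"
proof -
  let ?M = "point_measure \<Omega> (\<lambda>a. ennreal (P a))"
  interpret prob_space ?M by (rule prob_space_point_measure) fact
  interpret S: prob_space "stream_space ?M" by (rule prob_space_stream_space)
  have nn: "\<And>a. a \<in> \<Omega> \<Longrightarrow> 0 \<le> P a" using assms(2) by (auto simp: prob_on_def)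
  have meas: "sstart \<Omega> \<tau> \<in> sets (stream_space ?M)" if "\<tau> \<in> lists \<Omega>" for \<tau>
    using sets_bernoulli_measure[OF assms(1), of P] that
    by (auto simp: bernoulli_measure_def generated_open_singleton[symmetric] simp del: in_lists_conv_set)
  have "emeasure (stream_space ?M) (sstart \<Omega> \<sigma>) = ennreal (string_prob P \<sigma>)"
    using assms(3)
  proof (induction \<sigma>)
    case Nil
    then show ?case
      using S.emeasure_space_1 by (simp add: string_prob_def space_stream_space space_point_measure)
  next
    case (Cons a \<sigma>)
    have "emeasure (stream_space ?M) (sstart \<Omega> (a # \<sigma>)) =
        (\<integral>\<^sup>+t. emeasure (stream_space ?M) {x \<in> space (stream_space ?M). t ## x \<in> sstart \<Omega> (a # \<sigma>)} \<partial>?M)"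
      using Cons.hyps by (intro emeasure_stream_space meas) auto
    also have "\<dots> = (\<integral>\<^sup>+t. ennreal (string_prob P \<sigma>) * indicator {a} t \<partial>?M)"
    proof (rule nn_integral_cong)
      fix t
      have "{x \<in> space (stream_space ?M). t ## x \<in> sstart \<Omega> (a # \<sigma>)} =
          (if t = a then sstart \<Omega> \<sigma> else {})"
        using sstart_in_streams[OF Cons.hyps(2)] by (auto simp: space_stream_space space_point_measure)
      then show "emeasure (stream_space ?M) {x \<in> space (stream_space ?M). t ## x \<in> sstart \<Omega> (a # \<sigma>)} =
          ennreal (string_prob P \<sigma>) * indicator {a} t"
        using Cons.IH by (simp add: indicator_def)
    qed
    also have "\<dots> = ennreal (string_prob P \<sigma>) * emeasure ?M {a}"
      using Cons.hyps by (intro nn_integral_cmult_indicator) (simp add: sets_point_measure)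
    also have "emeasure ?M {a} = ennreal (P a)"
      using Cons.hyps nn by (subst emeasure_point_measure_finite2) auto
    also have "ennreal (string_prob P \<sigma>) * ennreal (P a) = ennreal (string_prob P (a # \<sigma>))"
      using nn[OF Cons.hyps(1)] by (simp add: string_prob_def ennreal_mult' mult.commute)
    finally show ?case .
  qed
  then show ?thesis
    by (simp add: bernoulli_measure_def generated_open_singleton[OF assms(3)])
qed

lemma bernoulli_measure_unique:
  assumes "countable \<Omega>" "prob_on \<Omega> P"
    and "sets M = sets (bernoulli_measure \<Omega> P)"
    and "\<And>\<sigma>. \<sigma> \<in> lists \<Omega> \<Longrightarrow> emeasure M (generated_open \<Omega> {\<sigma>}) = ennreal (string_prob P \<sigma>)"
  shows "M = bernoulli_measure \<Omega> P"
proof -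
  let ?E = "(\<lambda>\<sigma>. generated_open \<Omega> {\<sigma>}) ` lists \<Omega> \<union> {{}}"
  have E: "?E = sstart \<Omega> ` lists \<Omega> \<union> {{}}"
    by (auto simp: generated_open_singleton image_iff simp del: in_lists_conv_set)
  have top: "generated_open \<Omega> {[]} = streams \<Omega>"
    by (simp add: generated_open_singleton)
  show ?thesis
  proof (rule measure_eqI_generator_eq[where A = "\<lambda>_. streams \<Omega>" and E = ?E and \<Omega> = "streams \<Omega>"])
    show "Int_stable ?E" unfolding E by (rule Int_stable_sstart)
    show "?E \<subseteq> Pow (streams \<Omega>)" by (auto simp: generated_open_def)
    show "emeasure M X = emeasure (bernoulli_measure \<Omega> P) X" if "X \<in> ?E" for X
    proof (cases "X = {}")
      case False
      with that obtain \<sigma> where "\<sigma> \<in> lists \<Omega>" "X = generated_open \<Omega> {\<sigma>}" by blast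
      then show ?thesis
        by (metis assms(4) emeasure_bernoulli_measure_cylinder[OF assms(1,2)])
    qed simp
    show "sets M = sigma_sets (streams \<Omega>) ?E"
      using assms(3) sets_bernoulli_measure[OF assms(1)] by simp
    show "sets (bernoulli_measure \<Omega> P) = sigma_sets (streams \<Omega>) ?E"
      using sets_bernoulli_measure[OF assms(1)] .
    have "streams \<Omega> \<in> (\<lambda>\<sigma>. generated_open \<Omega> {\<sigma>}) ` lists \<Omega>"
      using top by (intro image_eqI[of _ _ "[]"]) auto
    then show "range (\<lambda>_::nat. streams \<Omega>) \<subseteq> ?E" by auto
    show "(\<Union>i::nat. streams \<Omega>) = streams \<Omega>" by simp
    show "emeasure M (streams \<Omega>) \<noteq> \<infinity>" for i :: nat
      using assms(4)[of "[]"] top by simp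
  qed
qed

end

theory Submission
  imports Defs
begin

text \<open>
  A test that defeats the filtered sequence can be pulled back to a test that defeats \<open>\<alpha>\<close>.
  Given a Martin-Loef test \<open>C\<close> for the conditioned probabilities, let level \<open>n\<close> of the new test consist
  of the strings over \<open>\<Omega>\<close> that end in a symbol of \<open>B\<close> and become an element of level \<open>n\<close> of \<open>C\<close> when the
  symbols outside \<open>B\<close> are deleted (\<open>filter_lift\<close>). These levels are prefix-free, and they can be
  enumerated because \<open>\<Omega>\<close> and \<open>C\<close> can and membership in \<open>B\<close> is decidable (\<open>re_pairs_filter_lift\<close>).

  The levels are small because filtering turns the Bernoulli measure of \<open>P\<close> into that of the
  conditioned space. For a single string \<open>\<tau>\<close> over \<open>B\<close>, the probability that the symbols in \<open>B\<close> begin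
  with \<open>\<tau>\<close> is the product of the conditional probabilities of its symbols (\<open>measure_filter_eq\<close>),
  and prefix-freeness extends this to the levels of a test (\<open>measure_filter_prefix_free\<close>).
  Working with open sets only avoids the treatment of filtering as a measurable map between
  spaces of sequences.

  All this presupposes that the filtered sequence is a genuine infinite sequence, that is, that
  \<open>\<alpha>\<close> meets \<open>B\<close> infinitely often. Otherwise, after some finite prefix, \<open>\<alpha>\<close> would avoid an event of
  positive probability forever; the probability of this for long stretches decays
  geometrically, which gives a test against \<open>\<alpha>\<close> (\<open>ensemble_infinitely_often\<close>).

  The enumerability claims need closure properties of the recursive functions: pairing and
  its inverses, case distinctions, and folds over coded lists. These are collected as
  introduction rules for a predicate on unary functions, which reduce each
  enumerability proof to writing down the enumerating function.
\<close>

section \<open>Closure properties of the recursive functions\<close>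

text \<open>
  The extensional closure of \<open>recursive_fun\<close>: the values on lists of the wrong length, which
  \<open>recursive_fun\<close> fixes as an accident of how a function was built, are forgotten, so that a
  recursive function can be replaced by any other description of it.
\<close>

definition total_recursive :: "nat \<Rightarrow> (nat list \<Rightarrow> nat) \<Rightarrow> bool" where
  "total_recursive n f \<longleftrightarrow> (\<exists>g. recursive_fun n g \<and> (\<forall>xs. length xs = n \<longrightarrow> f xs = g xs))"

lemma total_recursive_cong:
  assumes "total_recursive n f" "\<And>xs. length xs = n \<Longrightarrow> f xs = f' xs"
  shows "total_recursive n f'"
  using assms by (metis total_recursive_def)

lemma total_recursive_succ: "total_recursive 1 (\<lambda>xs. Suc (xs ! 0))"
  using recursive_fun.succ total_recursive_def by blast

lemma total_recursive_proj: "i < n \<Longrightarrow> total_recursive n (\<lambda>xs. xs ! i)"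
  using recursive_fun.proj total_recursive_def by blast

lemma total_recursive_zero: "total_recursive n (\<lambda>xs. 0)"
  using recursive_fun.zero total_recursive_def by blast

lemma total_recursive_comp:
  assumes "total_recursive (length gs) f" "\<And>g. g \<in> set gs \<Longrightarrow> total_recursive n g"
  shows "total_recursive n (\<lambda>xs. f (map (\<lambda>g. g xs) gs))"
proof -
  obtain f' where f': "recursive_fun (length gs) f'" "\<forall>xs. length xs = length gs \<longrightarrow> f xs = f' xs"
    using assms(1) by (auto simp: total_recursive_def)
  obtain r where r: "\<And>g. g \<in> set gs \<Longrightarrow> recursive_fun n (r g) \<and> (\<forall>xs. length xs = n \<longrightarrow> g xs = r g xs)"
    using assms(2) unfolding total_recursive_def by metis
  have "recursive_fun n (\<lambda>xs. f' (map (\<lambda>g. g xs) (map r gs)))"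
    by (rule recursive_fun.comp) (use f' r in auto)
  moreover have "f (map (\<lambda>g. g xs) gs) = f' (map (\<lambda>g. g xs) (map r gs))" if "length xs = n" for xs
  proof -
    have "map (\<lambda>g. g xs) gs = map (\<lambda>g. g xs) (map r gs)"
      using r that by simp
    then show ?thesis using f'(2) by (metis length_map)
  qed
  ultimately show ?thesis unfolding total_recursive_def by blast
qed

lemma total_recursive_comp1:
  "total_recursive 1 f \<Longrightarrow> total_recursive n a \<Longrightarrow> total_recursive n (\<lambda>xs. f [a xs])"
  using total_recursive_comp[of "[a]" f n] by simp

lemma total_recursive_comp2:
  "total_recursive 2 f \<Longrightarrow> total_recursive n a \<Longrightarrow> total_recursive n b \<Longrightarrow>
    total_recursive n (\<lambda>xs. f [a xs, b xs])"
  using total_recursive_comp[of "[a, b]" f n] by (auto simp: numeral_2_eq_2)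

lemma total_recursive_comp3:
  "total_recursive 3 f \<Longrightarrow> total_recursive n a \<Longrightarrow> total_recursive n b \<Longrightarrow> total_recursive n c \<Longrightarrow>
    total_recursive n (\<lambda>xs. f [a xs, b xs, c xs])"
  using total_recursive_comp[of "[a, b, c]" f n] by (auto simp: numeral_3_eq_3)

lemma total_recursive_Suc: "total_recursive n a \<Longrightarrow> total_recursive n (\<lambda>xs. Suc (a xs))"
  using total_recursive_comp1[OF total_recursive_succ] by simp

lemma total_recursive_prim_rec:
  assumes "total_recursive n f" "total_recursive (Suc (Suc n)) g"
  shows "total_recursive (Suc n) (\<lambda>xs. rec_nat (f (tl xs)) (\<lambda>y r. g (y # r # tl xs)) (hd xs))"
proof -
  obtain f' g' where f': "recursive_fun n f'" "\<And>xs. length xs = n \<Longrightarrow> f xs = f' xs"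
    and g': "recursive_fun (Suc (Suc n)) g'" "\<And>xs. length xs = Suc (Suc n) \<Longrightarrow> g xs = g' xs"
    using assms unfolding total_recursive_def by metis
  have "rec_nat (f (tl xs)) (\<lambda>y r. g (y # r # tl xs)) (hd xs)
      = rec_nat (f' (tl xs)) (\<lambda>y r. g' (y # r # tl xs)) (hd xs)" if "length xs = Suc n" for xs
    using f'(2)[of "tl xs"] g'(2)[of "_ # _ # tl xs"] that by simp
  then show ?thesis
    using recursive_fun.prim_rec[OF f'(1) g'(1)] unfolding total_recursive_def by blast
qed

lemma total_recursive_minimize:
  assumes "total_recursive (Suc n) f" "\<And>xs. length xs = n \<Longrightarrow> \<exists>y. f (y # xs) = 0"
  shows "total_recursive n (\<lambda>xs. LEAST y. f (y # xs) = 0)"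
proof -
  obtain f' where f': "recursive_fun (Suc n) f'" "\<And>xs. length xs = Suc n \<Longrightarrow> f xs = f' xs"
    using assms(1) unfolding total_recursive_def by metis
  have eq: "f (y # xs) = f' (y # xs)" if "length xs = n" for y xs
    using f'(2) that by simp
  have "recursive_fun n (\<lambda>xs. LEAST y. f' (y # xs) = 0)"
    using assms(2) eq by (intro recursive_fun.minimize f'(1)) metis
  then show ?thesis
    unfolding total_recursive_def using eq by (intro exI conjI) auto
qed

lemma total_recursive_rec_nat:
  assumes "total_recursive 1 f" "total_recursive 3 g"
  shows "total_recursive 2 (\<lambda>xs. rec_nat (f [xs ! 1]) (\<lambda>y r. g [y, r, xs ! 1]) (xs ! 0))"
proof -
  have "total_recursive (Suc 1) (\<lambda>xs. rec_nat (f (tl xs)) (\<lambda>y r. g (y # r # tl xs)) (hd xs))"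
    using assms by (intro total_recursive_prim_rec) (auto simp: numeral_3_eq_3)
  then show ?thesis
    unfolding numeral_2_eq_2 One_nat_def
    by (rule total_recursive_cong) (auto simp: length_Suc_conv)
qed

lemma total_recursive_add: "total_recursive 2 (\<lambda>xs. xs ! 0 + xs ! 1)"
proof (rule total_recursive_cong)
  show "total_recursive 2 (\<lambda>xs. rec_nat ([xs ! 1] ! 0) (\<lambda>y r. Suc ([y, r, xs ! 1] ! 1)) (xs ! 0))"
    by (rule total_recursive_rec_nat[of "\<lambda>xs. xs ! 0" "\<lambda>xs. Suc (xs ! 1)"])
      (auto intro!: total_recursive_proj total_recursive_Suc)
  fix xs :: "nat list"
  have "rec_nat b (\<lambda>y r. Suc r) a = a + b" for a b :: nat by (induction a) auto
  then show "rec_nat ([xs ! 1] ! 0) (\<lambda>y r. Suc ([y, r, xs ! 1] ! 1)) (xs ! 0) = xs ! 0 + xs ! 1"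
    by simp
qed

lemma total_recursive_pred: "total_recursive 1 (\<lambda>xs. xs ! 0 - 1)"
proof (rule total_recursive_cong)
  show "total_recursive 1 (\<lambda>xs. rec_nat 0 (\<lambda>y r. (y # r # tl xs) ! 0) (hd xs))"
    unfolding One_nat_def
    by (rule total_recursive_prim_rec[of 0 "\<lambda>_. 0" "\<lambda>xs. xs ! 0"])
      (auto intro: total_recursive_proj total_recursive_zero)
  show "rec_nat 0 (\<lambda>y r. (y # r # tl xs) ! 0) (hd xs) = xs ! 0 - 1" if "length xs = 1" for xs
    using that by (cases xs; cases "hd xs") auto
qed

lemma total_recursive_diff: "total_recursive 2 (\<lambda>xs. xs ! 1 - xs ! 0)"
proof (rule total_recursive_cong)
  have "total_recursive 3 (\<lambda>xs. [xs ! 1] ! 0 - 1)"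
    by (rule total_recursive_comp1[OF total_recursive_pred]) (auto intro: total_recursive_proj)
  then show "total_recursive 2 (\<lambda>xs. rec_nat ([xs ! 1] ! 0) (\<lambda>y r. [[y, r, xs ! 1] ! 1] ! 0 - 1) (xs ! 0))"
    by (intro total_recursive_rec_nat[of "\<lambda>xs. xs ! 0" "\<lambda>xs. [xs ! 1] ! 0 - 1"])
      (auto intro: total_recursive_proj)
  fix xs :: "nat list"
  have "rec_nat b (\<lambda>y r. r - 1) a = b - a" for a b :: nat by (induction a) auto
  then show "rec_nat ([xs ! 1] ! 0) (\<lambda>y r. [[y, r, xs ! 1] ! 1] ! 0 - 1) (xs ! 0) = xs ! 1 - xs ! 0"
    by simp
qed

lemma total_recursive_if_zero: "total_recursive 3 (\<lambda>xs. if xs ! 0 = 0 then xs ! 1 else xs ! 2)"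
proof (rule total_recursive_cong)
  show "total_recursive 3 (\<lambda>xs. rec_nat (tl xs ! 0) (\<lambda>y r. (y # r # tl xs) ! 3) (hd xs))"
    unfolding numeral_3_eq_3
    by (rule total_recursive_prim_rec[of 2 "\<lambda>xs. xs ! 0" "\<lambda>xs. xs ! 3", unfolded numeral_2_eq_2 numeral_3_eq_3])
      (auto intro: total_recursive_proj)
  show "rec_nat (tl xs ! 0) (\<lambda>y r. (y # r # tl xs) ! 3) (hd xs) = (if xs ! 0 = 0 then xs ! 1 else xs ! 2)"
    if "length xs = 3" for xs
    using that by (cases "hd xs") (auto simp: numeral_3_eq_3 numeral_2_eq_2 length_Suc_conv)
qed

lemma total_recursive_triangle: "total_recursive 1 (\<lambda>xs. triangle (xs ! 0))"
proof (rule total_recursive_cong)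
  have "total_recursive 2 (\<lambda>xs. [Suc (xs ! 0), xs ! 1] ! 0 + [Suc (xs ! 0), xs ! 1] ! 1)"
    by (rule total_recursive_comp2[OF total_recursive_add])
      (intro total_recursive_proj total_recursive_Suc; simp)+
  then show "total_recursive 1 (\<lambda>xs. rec_nat 0 (\<lambda>y r. Suc ((y # r # tl xs) ! 0) + (y # r # tl xs) ! 1) (hd xs))"
    unfolding One_nat_def
    by (intro total_recursive_prim_rec[of 0 "\<lambda>_. 0" "\<lambda>xs. Suc (xs ! 0) + xs ! Suc 0"])
      (auto intro: total_recursive_zero simp: numeral_2_eq_2)
  fix xs :: "nat list" assume l: "length xs = 1"
  have "rec_nat 0 (\<lambda>y r. Suc y + r) a = triangle a" for a by (induction a) auto
  then show "rec_nat 0 (\<lambda>y r. Suc ((y # r # tl xs) ! 0) + (y # r # tl xs) ! 1) (hd xs) = triangle (xs ! 0)"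
    using l by (cases xs) auto
qed

section \<open>Unary computable functions\<close>

text \<open>
  Tuples are coded by \<open>prod_encode\<close>, so functions of one argument suffice from here on. They compose
  as ordinary lambda terms, and computability proofs become applications of introduction rules.
\<close>

definition computable :: "(nat \<Rightarrow> nat) \<Rightarrow> bool" where
  "computable f \<longleftrightarrow> (\<exists>g. recursive_fun 1 g \<and> (\<forall>x. g [x] = f x))"

lemma computable_iff: "computable f \<longleftrightarrow> total_recursive 1 (\<lambda>xs. f (xs ! 0))"
proof
  assume "computable f"
  then obtain g where g: "recursive_fun 1 g" "\<And>x. g [x] = f x" by (auto simp: computable_def)
  then have "total_recursive 1 g" unfolding total_recursive_def by blast
  then show "total_recursive 1 (\<lambda>xs. f (xs ! 0))"
    by (rule total_recursive_cong) (auto simp: length_Suc_conv g)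
next
  assume "total_recursive 1 (\<lambda>xs. f (xs ! 0))"
  then obtain g where g: "recursive_fun 1 g" "\<And>xs. length xs = 1 \<Longrightarrow> f (xs ! 0) = g xs"
    unfolding total_recursive_def by blast
  from g(2)[of "[_]"] have "g [x] = f x" for x by simp
  with g(1) show "computable f" unfolding computable_def by blast
qed

named_theorems computable_intros

lemma computable_id [computable_intros]: "computable (\<lambda>x. x)"
  by (simp add: computable_iff total_recursive_proj)

lemma computable_comp:
  assumes "computable f" "computable a"
  shows "computable (\<lambda>x. f (a x))"
  using total_recursive_comp1[of "\<lambda>xs. f (xs ! 0)" 1 "\<lambda>xs. a (xs ! 0)"] assms
  by (simp add: computable_iff)

lemma computable_comp2:
  assumes "total_recursive 2 (\<lambda>xs. f (xs ! 0) (xs ! 1))" "computable a" "computable b"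
  shows "computable (\<lambda>x. f (a x) (b x))"
  using total_recursive_comp2[OF assms(1), of 1 "\<lambda>xs. a (xs ! 0)" "\<lambda>xs. b (xs ! 0)"] assms(2,3)
  by (simp add: computable_iff)

lemma computable_comp3:
  assumes "total_recursive 3 (\<lambda>xs. f (xs ! 0) (xs ! 1) (xs ! 2))"
    and "computable a" "computable b" "computable c"
  shows "computable (\<lambda>x. f (a x) (b x) (c x))"
  using total_recursive_comp3[OF assms(1), of 1 "\<lambda>xs. a (xs ! 0)" "\<lambda>xs. b (xs ! 0)" "\<lambda>xs. c (xs ! 0)"]
    assms(2-4)
  by (simp add: computable_iff numeral_2_eq_2)

lemma computable_Suc [computable_intros]: "computable a \<Longrightarrow> computable (\<lambda>x. Suc (a x))"
  by (simp add: computable_iff total_recursive_Suc)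

lemma computable_const [computable_intros]: "computable (\<lambda>x. c)"
proof (induction c)
  case 0
  then show ?case by (simp add: computable_iff total_recursive_zero)
qed (rule computable_Suc)

lemma computable_add [computable_intros]:
  "computable a \<Longrightarrow> computable b \<Longrightarrow> computable (\<lambda>x. a x + b x)"
  by (rule computable_comp2[OF total_recursive_add])

lemma computable_diff [computable_intros]:
  "computable a \<Longrightarrow> computable b \<Longrightarrow> computable (\<lambda>x. a x - b x)"
  by (rule computable_comp2[OF total_recursive_diff])

lemma computable_const_mult [computable_intros]: "computable a \<Longrightarrow> computable (\<lambda>x. k * a x)"
  by (induction k) (simp_all add: computable_intros)

lemma computable_if_eq [computable_intros]:
  assumes "computable a" "computable b" "computable c" "computable d"
  shows "computable (\<lambda>x. if a x = b x then c x else d x)"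
proof -
  have "computable (\<lambda>x. (a x - b x) + (b x - a x))"
    by (intro computable_intros assms)
  then have "computable (\<lambda>x. if (a x - b x) + (b x - a x) = 0 then c x else d x)"
    by (rule computable_comp3[OF total_recursive_if_zero]) fact+
  moreover have "(\<lambda>x. if (a x - b x) + (b x - a x) = 0 then c x else d x) =
      (\<lambda>x. if a x = b x then c x else d x)"
    by (rule ext) auto
  ultimately show ?thesis by simp
qed

lemma computable_triangle: "computable a \<Longrightarrow> computable (\<lambda>x. triangle (a x))"
  by (rule computable_comp[of triangle]) (use total_recursive_triangle in \<open>simp add: computable_iff\<close>)

lemma computable_prod_encode [computable_intros]:
  assumes "computable a" "computable b"
  shows "computable (\<lambda>x. prod_encode (a x, b x))"
  using assms by (auto simp: prod_encode_def intro!: computable_intros computable_triangle)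

text \<open>
  \<open>prod_encode (a, b)\<close> lies in the block of numbers from \<open>triangle (a + b)\<close> up to the next triangle number,
  so the index of that block, found by a minimization, gives both components by subtraction.
\<close>

definition triangle_root :: "nat \<Rightarrow> nat" where
  "triangle_root z = (LEAST k. z < triangle (Suc k))"

lemma triangle_mono: "a \<le> b \<Longrightarrow> triangle a \<le> triangle b"
  by (induction b) (auto simp: le_Suc_eq)

lemma triangle_root_prod_encode: "triangle_root (prod_encode (a, b)) = a + b"
  unfolding triangle_root_def
proof (rule Least_equality)
  show "prod_encode (a, b) < triangle (Suc (a + b))" by (simp add: prod_encode_def)
  fix k assume k: "prod_encode (a, b) < triangle (Suc k)"
  show "a + b \<le> k"
  proof (rule ccontr)
    assume "\<not> a + b \<le> k"
    then have "triangle (Suc k) \<le> triangle (a + b)" by (intro triangle_mono) simp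
    with k show False by (simp add: prod_encode_def)
  qed
qed

definition pair_fst :: "nat \<Rightarrow> nat" where "pair_fst z = fst (prod_decode z)"
definition pair_snd :: "nat \<Rightarrow> nat" where "pair_snd z = snd (prod_decode z)"

lemma pair_fst_encode [simp]: "pair_fst (prod_encode (a, b)) = a"
  and pair_snd_encode [simp]: "pair_snd (prod_encode (a, b)) = b"
  by (simp_all add: pair_fst_def pair_snd_def)

lemma computable_triangle_root: "computable triangle_root"
proof -
  let ?f = "\<lambda>xs. Suc (xs ! 1) - triangle (Suc (xs ! 0))"
  have tri: "total_recursive 2 (\<lambda>xs. triangle (Suc (xs ! 0)))"
    using total_recursive_comp1[OF total_recursive_triangle, of 2 "\<lambda>xs. Suc (xs ! 0)"]
    by (simp add: total_recursive_Suc total_recursive_proj del: triangle_Suc)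
  have "total_recursive 2 (\<lambda>xs. Suc (xs ! 1))"
    by (intro total_recursive_Suc total_recursive_proj) simp
  from total_recursive_comp2[OF total_recursive_diff tri this]
  have f: "total_recursive (Suc 1) ?f"
    by (simp add: numeral_2_eq_2 del: triangle_Suc)
  have ex: "\<exists>y. ?f (y # xs) = 0" for xs
    by (rule exI[of _ "xs ! 0"]) simp
  have "total_recursive 1 (\<lambda>xs. LEAST y. ?f (y # xs) = 0)"
    by (rule total_recursive_minimize[OF f ex])
  then show ?thesis
    unfolding computable_iff triangle_root_def
    by (rule total_recursive_cong) (simp add: Suc_le_eq del: triangle_Suc)
qed

lemma pair_eq_triangle_root:
  "pair_fst z = z - triangle (triangle_root z)"
  "pair_snd z = triangle_root z - pair_fst z"
proof -
  obtain a b where z: "z = prod_encode (a, b)" by (metis prod_decode_inverse surj_pair)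
  show "pair_fst z = z - triangle (triangle_root z)" "pair_snd z = triangle_root z - pair_fst z"
    unfolding z triangle_root_prod_encode by (simp_all) (simp add: prod_encode_def)
qed

lemma computable_pair_fst [computable_intros]: "computable a \<Longrightarrow> computable (\<lambda>x. pair_fst (a x))"
  unfolding pair_eq_triangle_root
  by (intro computable_intros computable_triangle computable_comp[OF computable_triangle_root])

lemma computable_pair_snd [computable_intros]: "computable a \<Longrightarrow> computable (\<lambda>x. pair_snd (a x))"
  unfolding pair_eq_triangle_root(2)
  by (intro computable_intros computable_comp[OF computable_triangle_root])

lemma computable_funpow [computable_intros]:
  assumes "computable step" "computable a" "computable b"
  shows "computable (\<lambda>x. (step ^^ a x) (b x))"
proof -
  have "total_recursive 2 (\<lambda>xs. rec_nat ([xs ! 1] ! 0) (\<lambda>y r. step ([y, r, xs ! 1] ! 1)) (xs ! 0))"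
    using total_recursive_comp1[of "\<lambda>xs. step (xs ! 0)" 3 "\<lambda>xs. xs ! 1"] assms(1)
    by (intro total_recursive_rec_nat[of "\<lambda>xs. xs ! 0" "\<lambda>xs. step (xs ! 1)"])
      (simp_all add: total_recursive_proj computable_iff)
  moreover have "rec_nat b (\<lambda>y r. step r) a = (step ^^ a) b" for a b by (induction a) auto
  ultimately have "total_recursive 2 (\<lambda>xs. (step ^^ (xs ! 0)) (xs ! 1))" by simp
  from computable_comp2[OF this assms(2,3)] show ?thesis .
qed

section \<open>Computing with coded lists\<close>

lemma list_encode_eq_0_iff: "list_encode xs = 0 \<longleftrightarrow> xs = []"
  by (cases xs) auto

lemma length_le_list_encode: "length l \<le> list_encode l"
  by (induction l) (auto intro: order_trans[OF _ le_prod_encode_2])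

text \<open>
  The fold is an iteration of a step that moves the head of a coded list into the accumulator
  and leaves a state with the empty list unchanged. As extra steps do no harm, the code of
  the list, which bounds its length, can serve as the number of steps.
\<close>

lemma computable_fold [computable_intros]:
  assumes "computable (\<lambda>z. f (pair_fst z) (pair_snd z))" "computable a" "computable b"
  shows "computable (\<lambda>x. fold f (list_decode (a x)) (b x))"
proof -
  let ?step = "\<lambda>s. if pair_fst s = 0 then s else
    prod_encode (pair_snd (pair_fst s - 1), f (pair_fst (pair_fst s - 1)) (pair_snd s))"
  have "computable (\<lambda>s. (\<lambda>z. f (pair_fst z) (pair_snd z))
      (prod_encode (pair_fst (pair_fst s - 1), pair_snd s)))"
    by (rule computable_comp[OF assms(1)]) (intro computable_intros)
  then have step: "computable ?step"
    by (auto intro!: computable_intros)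
  have sem: "(?step ^^ n) (prod_encode (list_encode l, c)) = prod_encode (0, fold f l c)"
    if "length l \<le> n" for n l c
    using that
  proof (induction n arbitrary: l c)
    case (Suc n)
    show ?case
    proof (cases l)
      case Nil
      then show ?thesis using Suc.IH[of "[]" c] by (simp add: funpow_swap1)
    next
      case (Cons x l')
      then have "?step (prod_encode (list_encode l, c)) = prod_encode (list_encode l', f x c)" by simp
      then show ?thesis using Suc.IH[of l' "f x c"] Suc.prems Cons
        by (simp add: funpow_Suc_right del: funpow.simps)
    qed
  qed simp
  have "computable (\<lambda>x. pair_snd ((?step ^^ a x) (prod_encode (a x, b x))))"
    by (intro computable_intros step assms)
  moreover have "pair_snd ((?step ^^ k) (prod_encode (k, c))) = fold f (list_decode k) c" for k c
    using sem[of "list_decode k" k c] length_le_list_encode[of "list_decode k"] by simp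
  ultimately show ?thesis by simp
qed

text \<open>
  A left-to-right fold builds its result back to front. The reversal is kept, because strings
  will be enumerated from arbitrary lists of indices, and these can be taken in reverse order.
\<close>

lemma fold_Cons_code:
  "fold (\<lambda>x c. Suc (prod_encode (g x, c))) l (list_encode s) = list_encode (rev (map g l) @ s)"
  by (induction l arbitrary: s) (simp_all flip: list_encode.simps)

lemma computable_rev_map [computable_intros]:
  assumes "computable g" "computable a"
  shows "computable (\<lambda>x. list_encode (rev (map g (list_decode (a x)))))"
proof -
  have "computable (\<lambda>x. fold (\<lambda>x c. Suc (prod_encode (g x, c))) (list_decode (a x)) 0)"
    by (intro computable_intros assms computable_comp[OF assms(1)])
  then show ?thesis using fold_Cons_code[of g _ "[]"] by simp
qed

text \<open>
  The inner conditional is the characteristic function of \<open>B\<close>: membership in \<open>B\<close> enters a computation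
  only through the values of this function.
\<close>

lemma fold_filter_code:
  "fold (\<lambda>x c. if (if g x \<in> B then 1 else 0) = (1::nat) then Suc (prod_encode (g x, c)) else c)
      l (list_encode s) =
    list_encode (rev (filter (\<lambda>b. b \<in> B) (map g l)) @ s)"
  by (induction l arbitrary: s) (simp_all flip: list_encode.simps)

lemma computable_rev_filter_map [computable_intros]:
  assumes "computable (\<lambda>x. if x \<in> B then 1 else 0)" "computable g" "computable a"
  shows "computable (\<lambda>x. list_encode (rev (filter (\<lambda>b. b \<in> B) (map g (list_decode (a x))))))"
proof -
  have "computable (\<lambda>x. fold
      (\<lambda>x c. if (if g x \<in> B then 1 else 0) = (1::nat) then Suc (prod_encode (g x, c)) else c)
      (list_decode (a x)) 0)"
    by (intro computable_intros computable_comp[OF assms(1)] computable_comp[OF assms(2)] assms(3))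
  then show ?thesis using fold_filter_code[of g B _ "[]"] by simp
qed

lemma computable_length [computable_intros]:
  assumes "computable a"
  shows "computable (\<lambda>x. length (list_decode (a x)))"
proof -
  have "fold (\<lambda>_ c. Suc c) l k = length l + k" for l :: "nat list" and k
    by (induction l arbitrary: k) simp_all
  moreover have "computable (\<lambda>x. fold (\<lambda>_ c. Suc c) (list_decode (a x)) 0)"
    by (intro computable_intros assms)
  ultimately show ?thesis by simp
qed

lemma computable_append_prefix [computable_intros]:
  assumes "computable (\<lambda>x. list_encode (f x))"
  shows "computable (\<lambda>x. list_encode (\<sigma> @ f x))"
  by (induction \<sigma>) (auto intro!: computable_intros assms)

section \<open>Recursively enumerable sets\<close>

lemma re_set_iff: "re_set A \<longleftrightarrow> A = {} \<or> (\<exists>f. computable f \<and> A = range f)"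
  unfolding re_set_def computable_def
proof -
  have "(\<exists>f. recursive_fun 1 f \<and> A = range (\<lambda>x. f [x])) \<longleftrightarrow>
    (\<exists>f. (\<exists>g. recursive_fun 1 g \<and> (\<forall>x. g [x] = f x)) \<and> A = range f)" (is "?L \<longleftrightarrow> ?R")
  proof
    assume ?L
    then obtain f where "recursive_fun 1 f" "A = range (\<lambda>x. f [x])" by blast
    then show ?R by (intro exI[of _ "\<lambda>x. f [x]"]) blast
  next
    assume ?R
    then obtain f g where "recursive_fun 1 g" "\<forall>x. g [x] = f x" "A = range f" by blast
    then show ?L by (intro exI[of _ g]) simp
  qed
  then show "A = {} \<or> (\<exists>f. recursive_fun 1 f \<and> A = range (\<lambda>x. f [x])) \<longleftrightarrow>
    A = {} \<or> (\<exists>f. (\<exists>g. recursive_fun 1 g \<and> (\<forall>x. g [x] = f x)) \<and> A = range f)" by simp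
qed

lemma re_set_obtain:
  assumes "re_set A" "A \<noteq> {}"
  obtains g where "computable g" "A = range g"
  using assms by (auto simp: re_set_iff)

lemma recursive_set_iff: "recursive_set A \<longleftrightarrow> computable (\<lambda>x. if x \<in> A then 1 else 0)"
  unfolding recursive_set_def computable_def by blast

text \<open>
  Enumerate all \<open>x\<close> and output \<open>h x\<close> if \<open>x\<close> passes the decidable filter, and some fixed element of the
  set otherwise.
\<close>

lemma re_set_image_Collect:
  assumes "computable h" "computable p" "computable q"
  shows "re_set (h ` {x. p x = q x})"
proof (cases "\<exists>d. p d = q d")
  case True
  then obtain d where d: "p d = q d" by blast
  have "h ` {x. p x = q x} = range (\<lambda>x. if p x = q x then h x else h d)"
    using d by (auto split: if_splits)
  moreover have "computable (\<lambda>x. if p x = q x then h x else h d)"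
    by (intro computable_intros assms)
  ultimately show ?thesis unfolding re_set_iff by blast
next
  case False
  then show ?thesis by (simp add: re_set_def)
qed

section \<open>Filtering and the Bernoulli measure\<close>

lemma set_stake_streams: "x \<in> streams A \<Longrightarrow> set (stake n x) \<subseteq> A"
  by (induction n arbitrary: x) (auto simp: streams_stl streams_shd)

lemma generated_open_measurable:
  fixes \<Omega> :: "nat set"
  shows "generated_open \<Omega> S \<in> sets (bernoulli_measure \<Omega> P)"
proof -
  have "generated_open \<Omega> S = (\<Union>\<sigma>\<in>S \<inter> lists \<Omega>. generated_open \<Omega> {\<sigma>})"
    using set_stake_streams[of _ \<Omega>] by (force simp: generated_open_def)
  moreover have "generated_open \<Omega> {\<sigma>} \<in> sets (bernoulli_measure \<Omega> P)" if "\<sigma> \<in> lists \<Omega>" for \<sigma>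
    unfolding sets_bernoulli_measure[of \<Omega>, simplified] using that by (intro sigma_sets.Basic) blast
  ultimately show ?thesis by (simp del: in_lists_conv_set)
qed

lemma emeasure_point_measure_event_prob:
  assumes "prob_on \<Omega> P" "B \<subseteq> \<Omega>"
  shows "emeasure (point_measure \<Omega> (\<lambda>a. ennreal (P a))) B = ennreal (event_prob P B)"
proof -
  have nn: "\<And>a. a \<in> B \<Longrightarrow> 0 \<le> P a" using assms by (auto simp: prob_on_def)
  have "P summable_on B"
    using assms summable_on_subset_banach has_sum_imp_summable unfolding prob_on_def by blast
  then have abs: "(\<lambda>a. norm (P a)) summable_on B"
    using nn by (simp cong: summable_on_cong)
  have "emeasure (point_measure \<Omega> (\<lambda>a. ennreal (P a))) B =
      (\<integral>\<^sup>+a. ennreal (P a) * indicator B a \<partial>count_space \<Omega>)"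
    using assms(2) by (simp add: point_measure_def emeasure_density)
  also have "\<dots> = (\<integral>\<^sup>+a. ennreal (P a) \<partial>count_space B)"
    using assms(2) by (subst (1 2) nn_integral_count_space_indicator)
      (auto intro!: nn_integral_cong split: split_indicator)
  also have "\<dots> = ennreal (infsum P B)"
    using nn abs by (subst nn_integral_conv_infsetsum)
      (auto simp: infsetsum_infsum abs_summable_equivalent[symmetric])
  finally show ?thesis by (simp add: event_prob_def)
qed

lemma conditioned_eq: "a \<in> B \<Longrightarrow> conditioned P B a = P a / event_prob P B"
  by (simp add: conditioned_def event_prob_def)

lemma prob_on_conditioned:
  assumes "prob_on \<Omega> P" "B \<subseteq> \<Omega>" "event_prob P B > 0"
  shows "prob_on B (conditioned P B)"
proof -
  have nn: "\<And>a. a \<in> B \<Longrightarrow> 0 \<le> P a" using assms by (auto simp: prob_on_def)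
  have "P summable_on B"
    using assms summable_on_subset_banach has_sum_imp_summable unfolding prob_on_def by blast
  then have "(P has_sum event_prob P B) B" by (simp add: event_prob_def)
  then have "((\<lambda>a. P a * inverse (event_prob P B)) has_sum 1) B"
    using has_sum_cmult_left[of P B "event_prob P B" "inverse (event_prob P B)"] assms(3) by simp
  then have "(conditioned P B has_sum 1) B"
    by (rule has_sum_cong[THEN iffD1, rotated]) (simp add: conditioned_eq divide_inverse)
  then show ?thesis using nn assms(3) by (simp add: prob_on_def conditioned_eq)
qed

lemma prob_space_bernoulli_measure:
  assumes "prob_on \<Omega> P"
  shows "prob_space (bernoulli_measure \<Omega> P)"
  unfolding bernoulli_measure_def
  using assms by (intro prob_space.prob_space_stream_space prob_space_point_measure)

lemma space_bernoulli_measure: "space (bernoulli_measure \<Omega> P) = streams \<Omega>"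
  by (simp add: bernoulli_measure_def space_stream_space space_point_measure)

context
  fixes \<Omega> B :: "nat set" and P :: "nat \<Rightarrow> real"
  assumes prob: "prob_on \<Omega> P" and sub: "B \<subseteq> \<Omega>"
begin

text \<open>
  The first symbol is independent of the rest of the sequence, so the measure of \<open>X\<close> is an average,
  over the first symbol, of the measure of the set of admissible continuations. Two nonempty sets of
  continuations, \<open>Y\<close> and \<open>Y'\<close>, are enough for waiting until a given symbol of \<open>B\<close> appears.
\<close>

lemma measure_first_symbol:
  assumes "\<And>t. t \<in> \<Omega> \<Longrightarrow> {x \<in> streams \<Omega>. t ## x \<in> X} = (if t \<in> A then Y else if t \<in> A' then Y' else {})"
    and "X \<in> sets (bernoulli_measure \<Omega> P)"
    and "A \<subseteq> \<Omega>" "A' \<subseteq> \<Omega>" "A \<inter> A' = {}"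
  shows "measure (bernoulli_measure \<Omega> P) X =
    event_prob P A * measure (bernoulli_measure \<Omega> P) Y +
    event_prob P A' * measure (bernoulli_measure \<Omega> P) Y'"
    (is "measure ?N X = _")
proof -
  let ?pt = "point_measure \<Omega> (\<lambda>a. ennreal (P a))"
  interpret pt: prob_space ?pt using prob by (rule prob_space_point_measure)
  interpret S: prob_space "bernoulli_measure \<Omega> P" using prob by (rule prob_space_bernoulli_measure)
  have nonneg: "0 \<le> event_prob P C" if "C \<subseteq> \<Omega>" for C
    using prob that unfolding event_prob_def by (intro infsum_nonneg) (auto simp: prob_on_def)
  have "emeasure ?N X =
      (\<integral>\<^sup>+t. emeasure ?N {x \<in> streams \<Omega>. t ## x \<in> X} \<partial>?pt)"
    using pt.emeasure_stream_space[of X] assms(2)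
    by (simp add: bernoulli_measure_def space_stream_space space_point_measure)
  also have "\<dots> = (\<integral>\<^sup>+t. ennreal (measure ?N Y) * indicator A t + ennreal (measure ?N Y') * indicator A' t \<partial>?pt)"
    using assms(1,5)
    by (intro nn_integral_cong)
      (auto simp: space_point_measure S.emeasure_eq_measure split: split_indicator)
  also have "\<dots> = ennreal (measure ?N Y) * emeasure ?pt A + ennreal (measure ?N Y') * emeasure ?pt A'"
    using assms(3,4) by (subst nn_integral_add) (auto simp: sets_point_measure nn_integral_cmult_indicator)
  also have "\<dots> = ennreal (event_prob P A * measure ?N Y + event_prob P A' * measure ?N Y')"
    using assms(3,4) nonneg
    by (simp add: emeasure_point_measure_event_prob[OF prob] ennreal_mult' ennreal_plus mult.commute)
  finally show ?thesis
    using assms(3,4) nonneg by (subst (asm) S.emeasure_eq_measure, subst (asm) ennreal_inj) auto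
qed

lemma event_prob_Diff: "event_prob P (\<Omega> - B) = 1 - event_prob P B"
proof -
  have "P summable_on \<Omega>" using prob by (auto simp: prob_on_def summable_on_def)
  moreover have "infsum P \<Omega> = 1" using prob by (auto simp: prob_on_def infsumI)
  ultimately show ?thesis
    using infsum_Diff[of P \<Omega> B] sub summable_on_subset_banach by (auto simp: event_prob_def)
qed

text \<open>
  The complement of \<open>B\<close> has probability \<open>1 - event_prob P B\<close>, the symbols are independent, and
  those before position \<open>m\<close> are unconstrained.
\<close>

lemma measure_avoid:
  "measure (bernoulli_measure \<Omega> P)
      (generated_open \<Omega> {\<rho>. length \<rho> = m + j \<and> set (drop m \<rho>) \<inter> B = {}}) =
    (1 - event_prob P B) ^ j"
  (is "measure ?N (?X m j) = _")
proof (induction m arbitrary: j)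
  case 0
  show ?case
  proof (induction j)
    case 0
    interpret S: prob_space "bernoulli_measure \<Omega> P" using prob by (rule prob_space_bernoulli_measure)
    have "?X 0 0 = streams \<Omega>" by (auto simp: generated_open_def)
    then show ?case using S.prob_space by (simp add: space_bernoulli_measure)
  next
    case (Suc j)
    have "measure ?N (?X 0 (Suc j)) = event_prob P (\<Omega> - B) * measure ?N (?X 0 j) + event_prob P {} * measure ?N {}"
    proof (rule measure_first_symbol)
      fix t assume t: "t \<in> \<Omega>"
      have "(\<exists>n. length (stake n (t ## x)) = Suc j \<and> set (stake n (t ## x)) \<inter> B = {}) \<longleftrightarrow>
        t \<notin> B \<and> (\<exists>n. length (stake n x) = j \<and> set (stake n x) \<inter> B = {})" for x
        by auto
      then show "{x \<in> streams \<Omega>. t ## x \<in> ?X 0 (Suc j)} =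
          (if t \<in> \<Omega> - B then ?X 0 j else if t \<in> {} then {} else {})"
        using t by (auto simp: generated_open_def streams_Stream)
    qed (auto simp: generated_open_measurable)
    then show ?case using Suc by (simp add: event_prob_Diff)
  qed
next
  case (Suc m)
  have "measure ?N (?X (Suc m) j) = event_prob P \<Omega> * measure ?N (?X m j) + event_prob P {} * measure ?N {}"
  proof (rule measure_first_symbol)
    fix t assume t: "t \<in> \<Omega>"
    have "(\<exists>n. length (stake n (t ## x)) = Suc m + j \<and> set (drop (Suc m) (stake n (t ## x))) \<inter> B = {}) \<longleftrightarrow>
      (\<exists>n. length (stake n x) = m + j \<and> set (drop m (stake n x)) \<inter> B = {})" for x
      by (auto intro!: exI[of _ "Suc _"] simp del: stake.simps) auto
    then show "{x \<in> streams \<Omega>. t ## x \<in> ?X (Suc m) j} =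
        (if t \<in> \<Omega> then ?X m j else if t \<in> {} then {} else {})"
      using t by (auto simp: generated_open_def streams_Stream)
  qed (auto simp: generated_open_measurable)
  moreover have "event_prob P \<Omega> = 1" using prob by (auto simp: event_prob_def prob_on_def infsumI)
  ultimately show ?case using Suc by simp
qed

text \<open>
  The probability that the symbols in \<open>B\<close> spell out \<open>\<tau>\<close> factors into the conditional
  probabilities of the symbols of \<open>\<tau>\<close>. With \<open>p = event_prob P B\<close>, conditioning on the first symbol
  shows that the measure \<open>m\<close> for \<open>b # \<tau>\<close> and the measure \<open>m'\<close> for \<open>\<tau>\<close> satisfy
  \<open>m = (1 - p) * m + P b * m'\<close>, that is, \<open>m = P b / p * m'\<close>.
\<close>

lemma measure_filter_eq:
  assumes "\<tau> \<in> lists B" "event_prob P B > 0"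
  shows "measure (bernoulli_measure \<Omega> P) (generated_open \<Omega> {\<sigma>. filter (\<lambda>b. b \<in> B) \<sigma> = \<tau>}) =
    string_prob (conditioned P B) \<tau>"
  (is "measure ?N _ = _")
  using assms(1)
proof (induction \<tau>)
  case Nil
  interpret S: prob_space "bernoulli_measure \<Omega> P" using prob by (rule prob_space_bernoulli_measure)
  have "\<exists>n. filter (\<lambda>b. b \<in> B) (stake n x) = []" for x by (rule exI[of _ 0]) simp
  then have "generated_open \<Omega> {\<sigma>. filter (\<lambda>b. b \<in> B) \<sigma> = []} = streams \<Omega>"
    by (auto simp: generated_open_def)
  then show ?case using S.prob_space by (simp add: space_bernoulli_measure string_prob_def)
next
  case (Cons b \<tau>)
  let ?X = "\<lambda>\<tau>. generated_open \<Omega> {\<sigma>. filter (\<lambda>b. b \<in> B) \<sigma> = \<tau>}"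
  \<comment> \<open>A first symbol outside \<open>B\<close> leaves \<open>b # \<tau>\<close> to be produced, a first symbol \<open>b\<close> leaves \<open>\<tau>\<close>,
    and any other symbol of \<open>B\<close> makes it impossible.\<close>
  have "measure ?N (?X (b # \<tau>)) =
      event_prob P (\<Omega> - B) * measure ?N (?X (b # \<tau>)) + event_prob P {b} * measure ?N (?X \<tau>)"
  proof (rule measure_first_symbol)
    fix t assume t: "t \<in> \<Omega>"
    have "(\<exists>n. filter (\<lambda>b. b \<in> B) (stake n (t ## x)) = b # \<tau>) \<longleftrightarrow>
       (\<exists>n. filter (\<lambda>b. b \<in> B) (t # stake n x) = b # \<tau>)" for x
      by (metis (no_types, lifting) filter.simps(1) list.distinct(1) not0_implies_Suc stake.simps stream.sel)
    then show "{x \<in> streams \<Omega>. t ## x \<in> ?X (b # \<tau>)} =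
        (if t \<in> \<Omega> - B then ?X (b # \<tau>) else if t \<in> {b} then ?X \<tau> else {})"
      using t Cons.hyps by (auto simp: generated_open_def streams_Stream simp del: stake.simps split: if_splits)
  qed (use Cons.hyps sub in \<open>auto simp: generated_open_measurable\<close>)
  then have "measure ?N (?X (b # \<tau>)) = (1 - event_prob P B) * measure ?N (?X (b # \<tau>)) + P b * measure ?N (?X \<tau>)"
    by (simp add: event_prob_Diff) (simp add: event_prob_def)
  then have "event_prob P B * measure ?N (?X (b # \<tau>)) = P b * measure ?N (?X \<tau>)"
    by (simp add: algebra_simps)
  then have "measure ?N (?X (b # \<tau>)) = P b / event_prob P B * measure ?N (?X \<tau>)"
    using assms(2) by (simp add: field_simps)
  then show ?case using Cons by (simp add: string_prob_def conditioned_eq)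
qed

text \<open>
  On both sides the open set splits, along the elements of \<open>S\<close>, into countably many pieces of
  equal measure. The pieces are disjoint: prefixes of one sequence are comparable, hence so are
  their filtered versions, while distinct elements of \<open>S\<close> are not.
\<close>

lemma measure_filter_prefix_free:
  assumes "S \<subseteq> lists B" "prefix_free S" "event_prob P B > 0"
  shows "measure (bernoulli_measure \<Omega> P) (generated_open \<Omega> {\<sigma>. filter (\<lambda>b. b \<in> B) \<sigma> \<in> S})
    = measure (bernoulli_measure B (conditioned P B)) (generated_open B S)"
proof -
  let ?X = "\<lambda>\<tau>. generated_open \<Omega> {\<sigma>. filter (\<lambda>b. b \<in> B) \<sigma> = \<tau>}"
  let ?N = "bernoulli_measure B (conditioned P B)"
  interpret M: prob_space "bernoulli_measure \<Omega> P" using prob by (rule prob_space_bernoulli_measure)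
  have cond: "prob_on B (conditioned P B)" using prob sub assms(3) by (rule prob_on_conditioned)
  interpret N: prob_space ?N using cond by (rule prob_space_bernoulli_measure)
  have comparable: "prefix (stake n x) (stake m x) \<or> prefix (stake m x) (stake n x)" for n m and x :: "nat stream"
    by (metis min.commute min_def nle_le take_is_prefix take_stake)
  have disj: "disjoint_family_on ?X S"
    unfolding disjoint_family_on_def
  proof (intro ballI impI equals0I)
    fix \<sigma> \<tau> x assume *: "\<sigma> \<in> S" "\<tau> \<in> S" "\<sigma> \<noteq> \<tau>" and "x \<in> ?X \<sigma> \<inter> ?X \<tau>"
    then obtain n m where nm: "filter (\<lambda>b. b \<in> B) (stake n x) = \<sigma>" "filter (\<lambda>b. b \<in> B) (stake m x) = \<tau>"
      by (auto simp: generated_open_def)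
    have "prefix \<sigma> \<tau> \<or> prefix \<tau> \<sigma>"
      using comparable[of n x m] unfolding nm[symmetric] by (auto intro: filter_mono_prefix)
    then show False using * assms(2) by (auto simp: prefix_free_def)
  qed
  have disj': "disjoint_family_on (\<lambda>\<tau>. generated_open B {\<tau>}) S"
    unfolding disjoint_family_on_def
  proof (intro ballI impI equals0I)
    fix \<sigma> \<tau> x assume *: "\<sigma> \<in> S" "\<tau> \<in> S" "\<sigma> \<noteq> \<tau>"
      and "x \<in> generated_open B {\<sigma>} \<inter> generated_open B {\<tau>}"
    then obtain n m where nm: "stake n x = \<sigma>" "stake m x = \<tau>" by (auto simp: generated_open_def)
    have "prefix \<sigma> \<tau> \<or> prefix \<tau> \<sigma>" using comparable[of n x m] nm by simp
    then show False using * assms(2) by (auto simp: prefix_free_def)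
  qed
  have "emeasure (bernoulli_measure \<Omega> P) (generated_open \<Omega> {\<sigma>. filter (\<lambda>b. b \<in> B) \<sigma> \<in> S})
      = emeasure (bernoulli_measure \<Omega> P) (\<Union>\<tau>\<in>S. ?X \<tau>)"
    by (rule arg_cong[of _ _ "emeasure _"]) (auto simp: generated_open_def)
  also have "\<dots> = (\<integral>\<^sup>+\<tau>. emeasure (bernoulli_measure \<Omega> P) (?X \<tau>) \<partial>count_space S)"
    by (intro emeasure_UN_countable disj) (auto simp: generated_open_measurable)
  also have "\<dots> = (\<integral>\<^sup>+\<tau>. emeasure ?N (generated_open B {\<tau>}) \<partial>count_space S)"
  proof (rule nn_integral_cong)
    fix \<tau> assume "\<tau> \<in> space (count_space S)"
    then have "\<tau> \<in> lists B" using assms(1) by auto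
    then show "emeasure (bernoulli_measure \<Omega> P) (?X \<tau>) = emeasure ?N (generated_open B {\<tau>})"
      using measure_filter_eq[OF _ assms(3)] emeasure_bernoulli_measure_cylinder[OF _ cond]
      by (simp add: M.emeasure_eq_measure del: in_lists_conv_set)
  qed
  also have "\<dots> = emeasure ?N (\<Union>\<tau>\<in>S. generated_open B {\<tau>})"
    by (intro emeasure_UN_countable[symmetric] disj') (auto simp: generated_open_measurable)
  also have "(\<Union>\<tau>\<in>S. generated_open B {\<tau>}) = generated_open B S"
    by (auto simp: generated_open_def)
  finally show ?thesis by (simp add: M.emeasure_eq_measure N.emeasure_eq_measure)
qed

end

section \<open>Prefixes of a filtered sequence\<close>

text \<open>
  The prefix of \<open>\<alpha>\<close> is cut right after the \<open>m\<close>-th occurrence of a symbol of \<open>B\<close>, which exists as there are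
  infinitely many. Ending in \<open>B\<close> is what makes this prefix eligible for a prefix-free pulled-back test.
\<close>

lemma stake_sfilter:
  assumes "alw (ev (holds (\<lambda>b. b \<in> B))) \<alpha>"
  shows "\<exists>n. filter (\<lambda>b. b \<in> B) (stake n \<alpha>) = stake m (sfilter (\<lambda>b. b \<in> B) \<alpha>) \<and>
    (m > 0 \<longrightarrow> n > 0 \<and> last (stake n \<alpha>) \<in> B)"
  using assms
proof (induction m arbitrary: \<alpha>)
  case 0
  show ?case by (rule exI[of _ 0]) simp
next
  case (Suc m)
  have "ev (holds (\<lambda>b. b \<in> B)) \<alpha>" using Suc.prems by (rule alwD)
  from this Suc.prems show ?case
  proof (induction rule: ev_induct_strong)
    case (base \<alpha>)
    then have "alw (ev (holds (\<lambda>b. b \<in> B))) (stl \<alpha>)"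
      unfolding alw_ev_stl by blast
    from Suc.IH[OF this] obtain n where n:
      "filter (\<lambda>b. b \<in> B) (stake n (stl \<alpha>)) = stake m (sfilter (\<lambda>b. b \<in> B) (stl \<alpha>))"
      "m > 0 \<Longrightarrow> n > 0 \<and> last (stake n (stl \<alpha>)) \<in> B" by blast
    show ?case
    proof (cases m)
      case 0
      then show ?thesis using base by (intro exI[of _ "Suc 0"]) simp
    next
      case (Suc m')
      then have "n > 0" "last (stake n (stl \<alpha>)) \<in> B" using n(2) by auto
      then show ?thesis using base n(1) by (intro exI[of _ "Suc n"]) (cases n; simp)
    qed
  next
    case (step \<alpha>)
    then obtain n where n: "filter (\<lambda>b. b \<in> B) (stake n (stl \<alpha>)) = stake (Suc m) (sfilter (\<lambda>b. b \<in> B) (stl \<alpha>))"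
      "n > 0 \<and> last (stake n (stl \<alpha>)) \<in> B" by auto
    then show ?case using step(2) by (intro exI[of _ "Suc n"]) (cases n; simp)
  qed
qed

section \<open>The event occurs infinitely often\<close>

lemma rev_map_surj:
  assumes "\<tau> \<in> lists (range g)"
  obtains l where "rev (map g l) = \<tau>"
proof -
  have "rev \<tau> \<in> lists (range g)" using assms by auto
  then have "rev \<tau> \<in> map g ` lists UNIV" unfolding lists_image .
  then show ?thesis using that by (metis image_iff rev_rev_ident)
qed

text \<open>
  With \<open>\<Omega>\<close> enumerated by \<open>g\<close>, run through all level numbers and all lists of indices, and keep those whose
  symbols avoid \<open>B\<close> and whose length fits the level. These conditions are decidable as \<open>B\<close> is.
\<close>

lemma re_pairs_avoiding_extensions:
  assumes "re_set \<Omega>" "\<Omega> \<noteq> {}" "recursive_set B"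
  shows "re_pairs {(n, \<sigma> @ \<tau>) | n \<tau>. n \<ge> 1 \<and> \<tau> \<in> lists (\<Omega> - B) \<and> length \<tau> = k * n}"
    (is "re_pairs ?C")
proof -
  obtain g where g: "computable g" "\<Omega> = range g" using assms(1,2) by (rule re_set_obtain)
  have chi: "computable (\<lambda>x. if x \<in> B then 1 else 0)" using assms(3) by (simp add: recursive_set_iff)
  let ?l = "\<lambda>z. list_decode (pair_snd z)"
  let ?h = "\<lambda>z. prod_encode (Suc (pair_fst z), list_encode (\<sigma> @ rev (map g (?l z))))"
  \<comment> \<open>Pairing both sides turns two conditions into a single equation.\<close>
  let ?p = "\<lambda>z. prod_encode (list_encode (rev (filter (\<lambda>b. b \<in> B) (map g (?l z)))), length (?l z))"
  let ?q = "\<lambda>z. prod_encode (0, k * Suc (pair_fst z))"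
  have "re_set (?h ` {z. ?p z = ?q z})"
    by (intro re_set_image_Collect computable_intros g(1) chi)
  also have "?h ` {z. ?p z = ?q z} = (\<lambda>(n, \<sigma>). prod_encode (n, list_encode \<sigma>)) ` ?C"
  proof (intro equalityI subsetI)
    fix c assume "c \<in> ?h ` {z. ?p z = ?q z}"
    then obtain z where z: "?p z = ?q z" and c: "c = ?h z" by blast
    have "rev (map g (?l z)) \<in> lists (\<Omega> - B)" "length (rev (map g (?l z))) = k * Suc (pair_fst z)"
      using z by (auto simp: list_encode_eq_0_iff filter_empty_conv g(2))
    then have "(Suc (pair_fst z), \<sigma> @ rev (map g (?l z))) \<in> ?C" by fastforce
    then show "c \<in> (\<lambda>(n, \<sigma>). prod_encode (n, list_encode \<sigma>)) ` ?C" unfolding c by force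
  next
    fix c assume "c \<in> (\<lambda>(n, \<sigma>). prod_encode (n, list_encode \<sigma>)) ` ?C"
    then obtain n \<tau> where c: "c = prod_encode (n, list_encode (\<sigma> @ \<tau>))"
      and n: "n \<ge> 1" "\<tau> \<in> lists (\<Omega> - B)" "length \<tau> = k * n" by auto
    have "\<tau> \<in> lists (range g)" using n(2) g(2) by auto
    then obtain l where l: "rev (map g l) = \<tau>" by (rule rev_map_surj)
    obtain i where i: "n = Suc i" using n(1) by (cases n) auto
    let ?z = "prod_encode (i, list_encode l)"
    have "filter (\<lambda>b. b \<in> B) (map g l) = []" "length l = k * n"
      using n(2,3) unfolding l[symmetric] by (auto simp: filter_empty_conv)
    then have "?p ?z = ?q ?z" by (simp add: i)
    moreover have "c = ?h ?z" by (simp add: c i l)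
    ultimately show "c \<in> ?h ` {z. ?p z = ?q z}" by blast
  qed
  finally show ?thesis by (simp add: re_pairs_def)
qed

text \<open>
  If \<open>\<alpha>\<close> avoided \<open>B\<close> from position \<open>m\<close> on, it would be caught by the test whose level \<open>n\<close> consists of
  the first \<open>m\<close> symbols of \<open>\<alpha>\<close> followed by \<open>k * n\<close> symbols outside \<open>B\<close>. The constant \<open>k\<close> makes
  \<open>(1 - event_prob P B) ^ k\<close> smaller than \<open>1 / 2\<close>, and the fixed prefix is finite information, so
  that it can be built into the enumeration.
\<close>

lemma ensemble_infinitely_often:
  assumes "re_set \<Omega>" "\<Omega> \<noteq> {}" "prob_on \<Omega> P" "B \<subseteq> \<Omega>" "recursive_set B" "event_prob P B > 0"
    and "ensemble \<Omega> P \<alpha>"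
  shows "alw (ev (holds (\<lambda>b. b \<in> B))) \<alpha>"
proof (rule ccontr)
  assume "\<not> ?thesis"
  then obtain m where m: "\<And>i. \<alpha> !! (m + i) \<notin> B"
    by (auto simp: alw_iff_sdrop ev_iff_sdrop sdrop_snth)
  have \<alpha>: "\<alpha> \<in> streams \<Omega>" using assms(7) by (simp add: ensemble_def martin_loef_random_def)
  interpret M: prob_space "bernoulli_measure \<Omega> P" using assms(3) by (rule prob_space_bernoulli_measure)
  let ?r = "1 - event_prob P B"
  have r: "?r < 1" using assms(6) by simp
  have "0 \<le> event_prob P (\<Omega> - B)"
    using assms(3) unfolding event_prob_def by (intro infsum_nonneg) (auto simp: prob_on_def)
  then have r0: "0 \<le> ?r" unfolding event_prob_Diff[OF assms(3,4)] .
  obtain k where k: "?r ^ k < 1 / 2" using real_arch_pow_inv[OF _ r, of "1/2"] by auto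
  define \<sigma> where "\<sigma> = stake m \<alpha>"
  define C where "C = {(n, \<sigma> @ \<tau>) | n \<tau>. n \<ge> 1 \<and> \<tau> \<in> lists (\<Omega> - B) \<and> length \<tau> = k * n}"
  have "martin_loef_test \<Omega> P C"
    unfolding martin_loef_test_def
  proof (intro conjI allI impI)
    show "C \<subseteq> {1..} \<times> lists \<Omega>"
      using set_stake_streams[OF \<alpha>, of m] by (auto simp: C_def \<sigma>_def)
    show "re_pairs C" unfolding C_def using assms(1,2,5) by (rule re_pairs_avoiding_extensions)
    fix n :: nat assume n: "1 \<le> n"
    show "prefix_free {\<sigma>. (n, \<sigma>) \<in> C}" by (auto simp: prefix_free_def C_def prefix_def)
    have "{\<sigma>. (n, \<sigma>) \<in> C} \<subseteq> {\<rho>. length \<rho> = m + k * n \<and> set (drop m \<rho>) \<inter> B = {}}"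
      by (auto simp: C_def \<sigma>_def)
    then have "M.prob (generated_open \<Omega> {\<sigma>. (n, \<sigma>) \<in> C})
        \<le> M.prob (generated_open \<Omega> {\<rho>. length \<rho> = m + k * n \<and> set (drop m \<rho>) \<inter> B = {}})"
      by (intro M.finite_measure_mono generated_open_measurable) (unfold generated_open_def, blast)
    also have "\<dots> = (?r ^ k) ^ n"
      using measure_avoid[OF assms(3,4)] by (simp add: power_mult)
    also have "\<dots> < (1 / 2) ^ n"
      using k r0 n by (intro power_strict_mono) auto
    finally show "M.prob (generated_open \<Omega> {\<sigma>. (n, \<sigma>) \<in> C}) < 1 / 2 ^ n"
      by (simp add: power_one_over)
  qed
  then obtain n where n: "n \<ge> 1" "\<alpha> \<notin> generated_open \<Omega> {\<sigma>. (n, \<sigma>) \<in> C}"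
    using assms(7) by (auto simp: ensemble_def martin_loef_random_def)
  have "set (stake (k * n) (sdrop m \<alpha>)) \<subseteq> \<Omega>"
    using \<alpha> by (intro set_stake_streams) (simp add: streams_iff_snth sdrop_snth)
  moreover have "set (stake (k * n) (sdrop m \<alpha>)) \<inter> B = {}"
    using m by (auto simp: in_set_conv_nth sdrop_snth)
  ultimately have "stake (k * n) (sdrop m \<alpha>) \<in> lists (\<Omega> - B)" by auto
  then have "(n, \<sigma> @ stake (k * n) (sdrop m \<alpha>)) \<in> C"
    using n(1) unfolding C_def
    by (intro CollectI exI[of _ n] exI[of _ "stake (k * n) (sdrop m \<alpha>)"]) simp
  then have "(n, stake (m + k * n) \<alpha>) \<in> C" by (simp add: \<sigma>_def stake_add)
  with n \<alpha> show False by (auto simp: generated_open_def)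
qed

section \<open>Lifting tests along the filter\<close>

text \<open>
  Among all strings that filter to an element of \<open>S\<close>, only those ending in a symbol of \<open>B\<close> are taken:
  further symbols outside \<open>B\<close> would not change the filtered string and would destroy
  prefix-freeness.
\<close>

definition filter_lift :: "'a set \<Rightarrow> 'a set \<Rightarrow> 'a list set \<Rightarrow> 'a list set" where
  "filter_lift \<Omega> B S = {\<sigma> \<in> lists \<Omega>. \<sigma> \<noteq> [] \<and> last \<sigma> \<in> B \<and> filter (\<lambda>b. b \<in> B) \<sigma> \<in> S}"

lemma prefix_free_filter_lift:
  assumes "prefix_free S"
  shows "prefix_free (filter_lift \<Omega> B S)"
  unfolding prefix_free_def
proof (intro ballI impI)
  fix \<sigma> \<tau> assume *: "\<sigma> \<in> filter_lift \<Omega> B S" "\<tau> \<in> filter_lift \<Omega> B S" "prefix \<sigma> \<tau>"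
  then obtain \<rho> where \<rho>: "\<tau> = \<sigma> @ \<rho>" by (auto simp: prefix_def)
  have "filter (\<lambda>b. b \<in> B) \<sigma> = filter (\<lambda>b. b \<in> B) \<tau>"
    using assms * filter_mono_prefix[OF *(3)] by (auto simp: prefix_free_def filter_lift_def)
  then have "filter (\<lambda>b. b \<in> B) \<rho> = []" by (simp add: \<rho>)
  moreover have "last \<rho> \<in> B" if "\<rho> \<noteq> []" using *(2) that by (simp add: \<rho> filter_lift_def)
  ultimately have "\<rho> = []" by (metis filter_empty_conv last_in_set)
  then show "\<sigma> = \<tau>" by (simp add: \<rho>)
qed

text \<open>
  Enumerate \<open>C\<close> by \<open>f\<close> and \<open>\<Omega>\<close> by \<open>g\<close>, run through all pairs of an index \<open>y\<close> for \<open>C\<close> and a nonempty list of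
  indices for \<open>\<Omega>\<close>, and keep the pairs for which the string filters to the one given by \<open>f y\<close>. The
  string is read off in reverse, so its last symbol is the first one of the list.
\<close>

lemma re_pairs_filter_lift:
  assumes "re_set \<Omega>" "\<Omega> \<noteq> {}" "recursive_set B" "re_pairs C"
  shows "re_pairs {(n, \<sigma>). \<sigma> \<in> filter_lift \<Omega> B {\<tau>. (n, \<tau>) \<in> C}}"
    (is "re_pairs ?D")
proof (cases "C = {}")
  case True
  then show ?thesis by (simp add: filter_lift_def re_pairs_def re_set_def)
next
  case False
  let ?enc = "\<lambda>(n, \<sigma>). prod_encode (n, list_encode \<sigma>)"
  obtain g where g: "computable g" "\<Omega> = range g" using assms(1,2) by (rule re_set_obtain)
  obtain f where f: "computable f" "?enc ` C = range f"
    using assms(4) False unfolding re_pairs_def by (elim re_set_obtain) auto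
  have f_iff: "(n, \<tau>) \<in> C \<longleftrightarrow> (\<exists>y. f y = ?enc (n, \<tau>))" for n \<tau>
  proof -
    have "(n, \<tau>) \<in> C \<longleftrightarrow> ?enc (n, \<tau>) \<in> ?enc ` C" by (auto simp: list_encode_eq)
    also have "\<dots> \<longleftrightarrow> (\<exists>y. f y = ?enc (n, \<tau>))"
      unfolding f(2) image_iff by (simp add: eq_commute)
    finally show ?thesis .
  qed
  let ?chi = "\<lambda>x. if x \<in> B then 1 else 0 :: nat"
  have chi: "computable ?chi" using assms(3) by (simp add: recursive_set_iff)
  \<comment> \<open>Codes of nonempty lists are exactly the successors.\<close>
  let ?l = "\<lambda>z. list_decode (Suc (pair_snd z))"
  let ?h = "\<lambda>z. prod_encode (pair_fst (f (pair_fst z)), list_encode (rev (map g (?l z))))"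
  let ?p = "\<lambda>z. prod_encode (?chi (g (pair_fst (pair_snd z))), pair_snd (f (pair_fst z)))"
  let ?q = "\<lambda>z. prod_encode (1, list_encode (rev (filter (\<lambda>b. b \<in> B) (map g (?l z)))))"
  have "re_set (?h ` {z. ?p z = ?q z})"
    by (intro re_set_image_Collect computable_intros computable_comp[OF f(1)] computable_comp[OF chi]
        computable_comp[OF g(1)] g(1) chi)
  also have "?h ` {z. ?p z = ?q z} = ?enc ` ?D"
  proof (intro equalityI subsetI)
    fix c assume "c \<in> ?h ` {z. ?p z = ?q z}"
    then obtain z where z: "?p z = ?q z" and c: "c = ?h z" by blast
    obtain y x l where zz: "z = prod_encode (y, prod_encode (x, list_encode l))"
      by (metis list_decode_inverse prod_decode_inverse surj_pair)
    obtain n \<tau> where n: "f y = ?enc (n, \<tau>)" "(n, \<tau>) \<in> C"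
    proof -
      have "f y \<in> ?enc ` C" unfolding f(2) by simp
      then show ?thesis using that by auto
    qed
    have "g x \<in> B" "\<tau> = filter (\<lambda>b. b \<in> B) (rev (map g (x # l)))"
      using z by (auto simp: zz n(1) list_encode_eq rev_filter split: if_splits)
    then have "(n, rev (map g (x # l))) \<in> ?D"
      using n(2) by (auto simp: filter_lift_def g(2))
    moreover have "c = ?enc (n, rev (map g (x # l)))" by (simp add: c zz n(1))
    ultimately show "c \<in> ?enc ` ?D" by blast
  next
    fix c assume "c \<in> ?enc ` ?D"
    then obtain n \<sigma> where c: "c = ?enc (n, \<sigma>)" and \<sigma>: "\<sigma> \<in> lists \<Omega>" "\<sigma> \<noteq> []" "last \<sigma> \<in> B"
      "(n, filter (\<lambda>b. b \<in> B) \<sigma>) \<in> C" by (auto simp: filter_lift_def)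
    obtain y where y: "f y = ?enc (n, filter (\<lambda>b. b \<in> B) \<sigma>)" using \<sigma>(4) f_iff by blast
    obtain L where L: "rev (map g L) = \<sigma>" using \<sigma>(1) unfolding g(2) by (rule rev_map_surj)
    obtain x l where xl: "L = x # l" using \<sigma>(2) L by (cases L) auto
    let ?z = "prod_encode (y, prod_encode (x, list_encode l))"
    have "?p ?z = ?q ?z" using \<sigma>(3) by (simp add: y xl rev_filter flip: L)
    moreover have "c = ?h ?z" by (simp add: c y xl flip: L)
    ultimately show "c \<in> ?h ` {z. ?p z = ?q z}" by blast
  qed
  finally show ?thesis by (simp add: re_pairs_def)
qed

lemma martin_loef_test_filter_lift:
  assumes "re_set \<Omega>" "\<Omega> \<noteq> {}" "prob_on \<Omega> P" "B \<subseteq> \<Omega>" "recursive_set B" "event_prob P B > 0"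
    and "martin_loef_test B (conditioned P B) C"
  shows "martin_loef_test \<Omega> P {(n, \<sigma>). \<sigma> \<in> filter_lift \<Omega> B {\<tau>. (n, \<tau>) \<in> C}}"
proof -
  interpret M: prob_space "bernoulli_measure \<Omega> P" using assms(3) by (rule prob_space_bernoulli_measure)
  have C: "C \<subseteq> {1..} \<times> lists B" "re_pairs C"
    and pf: "\<And>n. n \<ge> 1 \<Longrightarrow> prefix_free {\<tau>. (n, \<tau>) \<in> C}"
    and small: "\<And>n. n \<ge> 1 \<Longrightarrow> measure (bernoulli_measure B (conditioned P B))
      (generated_open B {\<tau>. (n, \<tau>) \<in> C}) < 1 / 2 ^ n"
    using assms(7) by (auto simp: martin_loef_test_def)
  show ?thesis
    unfolding martin_loef_test_def
  proof (intro conjI allI impI)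
    show "{(n, \<sigma>). \<sigma> \<in> filter_lift \<Omega> B {\<tau>. (n, \<tau>) \<in> C}} \<subseteq> {1..} \<times> lists \<Omega>"
      using C(1) by (auto simp: filter_lift_def)
    show "re_pairs {(n, \<sigma>). \<sigma> \<in> filter_lift \<Omega> B {\<tau>. (n, \<tau>) \<in> C}}"
      using assms(1,2,5) C(2) by (rule re_pairs_filter_lift)
    fix n :: nat assume n: "1 \<le> n"
    let ?S = "{\<tau>. (n, \<tau>) \<in> C}"
    show "prefix_free {\<sigma>. (n, \<sigma>) \<in> {(n, \<sigma>). \<sigma> \<in> filter_lift \<Omega> B {\<tau>. (n, \<tau>) \<in> C}}}"
      using prefix_free_filter_lift[OF pf[OF n]] by simp
    have "M.prob (generated_open \<Omega> (filter_lift \<Omega> B ?S))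
        \<le> M.prob (generated_open \<Omega> {\<sigma>. filter (\<lambda>b. b \<in> B) \<sigma> \<in> ?S})"
      by (intro M.finite_measure_mono generated_open_measurable)
        (auto simp: generated_open_def filter_lift_def)
    also have "\<dots> = measure (bernoulli_measure B (conditioned P B)) (generated_open B ?S)"
      using C(1) by (intro measure_filter_prefix_free assms pf n) auto
    also have "\<dots> < 1 / 2 ^ n" using n by (rule small)
    finally show "M.prob (generated_open \<Omega>
        {\<sigma>. (n, \<sigma>) \<in> {(n, \<sigma>). \<sigma> \<in> filter_lift \<Omega> B {\<tau>. (n, \<tau>) \<in> C}}}) < 1 / 2 ^ n"
      by simp
  qed
qed

text \<open>
  The empty string generates the whole space, of measure 1, which no level of a test can
  afford.
\<close>

lemma martin_loef_test_Nil:
  assumes "prob_on \<Omega> P" "martin_loef_test \<Omega> P C" "n \<ge> 1"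
  shows "(n, []) \<notin> C"
proof
  assume "(n, []) \<in> C"
  then have "generated_open \<Omega> {\<sigma>. (n, \<sigma>) \<in> C} = streams \<Omega>"
    by (auto simp: generated_open_def intro: exI[of _ 0])
  moreover interpret M: prob_space "bernoulli_measure \<Omega> P"
    using assms(1) by (rule prob_space_bernoulli_measure)
  have "M.prob (streams \<Omega>) = 1" using M.prob_space by (simp add: space_bernoulli_measure)
  ultimately have "1 < 1 / (2 :: real) ^ n" using assms(2,3) by (auto simp: martin_loef_test_def)
  moreover have "1 \<le> (2 :: real) ^ n" by simp
  ultimately show False by (simp add: divide_simps)
qed

section \<open>Conditioning preserves randomness\<close>

theorem theorem39:
  fixes \<Omega> B :: "nat set" and P :: "nat \<Rightarrow> real" and \<alpha> :: "nat stream"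
  assumes "re_set \<Omega>" and "infinite \<Omega>"
    and "prob_on \<Omega> P"
    and "B \<subseteq> \<Omega>" and "recursive_set B" and "event_prob P B > 0"
    and "ensemble \<Omega> P \<alpha>"
  shows "ensemble B (conditioned P B) (filtered B \<alpha>)"
proof -
  have ne: "\<Omega> \<noteq> {}" using assms(2) by auto
  have \<alpha>: "\<alpha> \<in> streams \<Omega>" using assms(7) by (simp add: ensemble_def martin_loef_random_def)
  have inf: "alw (ev (holds (\<lambda>b. b \<in> B))) \<alpha>"
    using assms(1) ne assms(3-7) by (rule ensemble_infinitely_often)
  have "filtered B \<alpha> \<in> streams {x \<in> \<Omega>. x \<in> B}"
    unfolding filtered_def using inf \<alpha> by (rule sfilter_streams)
  moreover have "{x \<in> \<Omega>. x \<in> B} = B" using assms(4) by auto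
  ultimately have "filtered B \<alpha> \<in> streams B" by simp
  moreover have "\<exists>n\<ge>1. filtered B \<alpha> \<notin> generated_open B {\<sigma>. (n, \<sigma>) \<in> C}"
    if C: "martin_loef_test B (conditioned P B) C" for C
  proof -
    let ?D = "{(n, \<sigma>). \<sigma> \<in> filter_lift \<Omega> B {\<tau>. (n, \<tau>) \<in> C}}"
    have "martin_loef_test \<Omega> P ?D"
      using assms(1) ne assms(3-6) C by (rule martin_loef_test_filter_lift)
    then obtain n where n: "n \<ge> 1" "\<alpha> \<notin> generated_open \<Omega> {\<sigma>. (n, \<sigma>) \<in> ?D}"
      using assms(7) by (auto simp: ensemble_def martin_loef_random_def)
    have "filtered B \<alpha> \<notin> generated_open B {\<sigma>. (n, \<sigma>) \<in> C}"
    proof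
      assume "filtered B \<alpha> \<in> generated_open B {\<sigma>. (n, \<sigma>) \<in> C}"
      then obtain m where m: "(n, stake m (filtered B \<alpha>)) \<in> C" by (auto simp: generated_open_def)
      have "m > 0"
        using m martin_loef_test_Nil[OF prob_on_conditioned[OF assms(3,4,6)] C n(1)] by (cases m) auto
      then obtain j where "filter (\<lambda>b. b \<in> B) (stake j \<alpha>) = stake m (filtered B \<alpha>)"
        "j > 0" "last (stake j \<alpha>) \<in> B"
        using stake_sfilter[OF inf, of m] by (auto simp: filtered_def)
      then have "stake j \<alpha> \<in> filter_lift \<Omega> B {\<tau>. (n, \<tau>) \<in> C}"
        using m set_stake_streams[OF \<alpha>, of j] by (auto simp: filter_lift_def)
      then show False using n(2) \<alpha> by (auto simp: generated_open_def)
    qed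
    then show ?thesis using n(1) by blast
  qed
  ultimately show ?thesis by (simp add: ensemble_def martin_loef_random_def)
qed

end
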